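(* Let $C$ be a $2$-torsion free commutative ring with unity, let $n\geq 2$, and let $\mathcal{T}_n(C)$ be the $C$-algebra of $n\times n$ upper triangular matrices over $C$. Let $f,g,h:\mathcal{T}_n(C)\rightarrow \mathcal{T}_n(C)$ be $C$-linear maps. Then $f$ is a left $\{g,h\}$-derivation if and only if there exist $2n$ elements $g_{1i}^{(11)},h_{1i}^{(11)}\in C$ ($1\leq i\leq n$) such that for every $A=\sum_{1\leq i\leq j\leq n}a_{ij}e_{ij}\in\mathcal{T}_n(C)$ (with $a_{ij}\in C$), $$g(A)=\sum_{i=1}^{n}a_{11}g_{1i}^{(11)}e_{1i},\qquad h(A)=\sum_{i=1}^{n}a_{11}h_{1i}^{(11)}e_{1i},\qquad f(A)=g(A)+h(A).$$
   Context: A ring $R$ is $2$-torsion free if $2a=0$ with $a\in R$ implies $a=0$. For an algebra $A$ over $C$ and $C$-linear maps $f,g,h:A\to A$, $f$ is a left $\{g,h\}$-derivation if $f(ab)=a\,g(b)+b\,h(a)=a\,h(b)+b\,g(a)$ for all $a,b\in A$. $e_{ij}$ denotes the matrix whose $(i,j)$ entry is $1$ and whose other entries are $0$. The superscripts in $g_{1i}^{(11)}$ and $h_{1i}^{(11)}$ are just part of the names of the elements. *)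

theory Defs
  imports "Jordan_Normal_Form.Matrix"
begin

(* Commutative rings with unity are represented by types of sort {comm_ring, comm_monoid_mult}.
   Unlike comm_ring_1, this sort does not demand 0 \<noteq> 1, so the zero ring is included. *)

definition two_torsion_free :: "'a::comm_ring itself \<Rightarrow> bool" where
  "two_torsion_free _ \<longleftrightarrow> (\<forall>a::'a. a + a = 0 \<longrightarrow> a = 0)"

definition upper_triangular_mats :: "nat \<Rightarrow> 'a::zero mat set" where
  "upper_triangular_mats n = {A \<in> carrier_mat n n. upper_triangular A}"

(* Rows and columns are numbered from 0, as in the underlying matrix library:
   matrix_unit n i j is the matrix e with indices i+1, j+1 in the usual numbering from 1. *)
definition matrix_unit :: "nat \<Rightarrow> nat \<Rightarrow> nat \<Rightarrow> 'a::{zero,one} mat" where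
  "matrix_unit n i j = mat n n (\<lambda>(k, l). if k = i \<and> l = j then 1 else 0)"

(* The type of matrices of all sizes has no zero, so sum is not applicable to it. *)
definition mats_sum :: "nat \<Rightarrow> ('i \<Rightarrow> 'a::comm_monoid_add mat) \<Rightarrow> 'i set \<Rightarrow> 'a mat" where
  "mats_sum n F I = mat n n (\<lambda>(k, l). \<Sum>i\<in>I. F i $$ (k, l))"

(* Linear endomorphisms of a space M of matrices; the values outside M are irrelevant. *)
definition linear_endo_on ::
    "'a::{comm_ring, comm_monoid_mult} mat set \<Rightarrow> ('a mat \<Rightarrow> 'a mat) \<Rightarrow> bool" where
  "linear_endo_on M f \<longleftrightarrow>
     (\<forall>A\<in>M. f A \<in> M) \<and>
     (\<forall>A\<in>M. \<forall>B\<in>M. f (A + B) = f A + f B) \<and>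
     (\<forall>c. \<forall>A\<in>M. f (c \<cdot>\<^sub>m A) = c \<cdot>\<^sub>m f A)"

definition left_derivation_on ::
    "'b::{plus,times} set \<Rightarrow> ('b \<Rightarrow> 'b) \<Rightarrow> ('b \<Rightarrow> 'b) \<Rightarrow> ('b \<Rightarrow> 'b) \<Rightarrow> bool" where
  "left_derivation_on M g h f \<longleftrightarrow>
     (\<forall>a\<in>M. \<forall>b\<in>M. f (a * b) = a * g b + b * h a \<and> a * g b + b * h a = a * h b + b * g a)"

end

theory Submission
  imports Defs
begin

text \<open>
  Put \<open>G = g 1\<close> and \<open>H = h 1\<close>. Setting one argument to \<open>1\<close> gives \<open>f a = g a + a H = h a + a G\<close>.
  For an idempotent \<open>e\<close> we have \<open>f e = e (g e) + e (h e)\<close>, so \<open>f e\<close> is fixed by left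
  multiplication by \<open>e\<close>; comparing the three expressions for \<open>f e = e (f e)\<close> yields \<open>g e = e G\<close>.
  Since the idempotents \<open>e\<^sub>i\<^sub>i\<close> and \<open>e\<^sub>i\<^sub>i + e\<^sub>i\<^sub>j\<close> span the triangular matrices, \<open>g a = a G\<close>, and by
  symmetry \<open>h a = a H\<close>, for all \<open>a\<close>. The identity for \<open>f (a b)\<close> now says
  \<open>a b H = b a H\<close>; the choice \<open>a = e\<^sub>1\<^sub>1\<close>, \<open>b = e\<^sub>1\<^sub>j\<close> with \<open>j > 1\<close> gives \<open>e\<^sub>1\<^sub>j H = 0\<close>, so only the
  first row of \<open>H\<close>, and likewise of \<open>G\<close>, can be nonzero, and then \<open>a G = a\<^sub>1\<^sub>1 G\<close> for triangular \<open>a\<close>.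
\<close>

section \<open>Cancellation and the identity for matrices\<close>

lemma add_mat_left_cancel:
  fixes A B D :: "'a::cancel_semigroup_add mat"
  assumes "A \<in> carrier_mat m n" "B \<in> carrier_mat m n" "D \<in> carrier_mat m n" "A + B = A + D"
  shows "B = D"
proof (rule eq_matI)
  fix i j assume "i < dim_row D" "j < dim_col D"
  moreover from this have "(A + B) $$ (i, j) = (A + D) $$ (i, j)"
    using assms(4) by simp
  ultimately show "B $$ (i, j) = D $$ (i, j)" using assms(1-3) by simp
qed (use assms in auto)

text \<open>The library's counterpart assumes the class \<open>semiring_1\<close>, which excludes the zero ring.\<close>

lemma one_mat_mult:
  fixes A :: "'a::{comm_ring, comm_monoid_mult} mat"
  assumes "A \<in> carrier_mat n m"
  shows "1\<^sub>m n * A = A"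
  using assms
  by (intro eq_matI) (auto simp: scalar_prod_def if_distrib[of "\<lambda>x. x * _"] cong: if_cong)

section \<open>Closure properties of the triangular matrices\<close>

lemma upper_triangular_matsD:
  assumes "A \<in> upper_triangular_mats n"
  shows "A \<in> carrier_mat n n" "\<And>i j. i < n \<Longrightarrow> j < i \<Longrightarrow> A $$ (i, j) = 0"
  using assms by (auto simp: upper_triangular_mats_def)

lemma upper_triangular_matsI:
  assumes "A \<in> carrier_mat n n" "\<And>i j. i < n \<Longrightarrow> j < i \<Longrightarrow> A $$ (i, j) = 0"
  shows "A \<in> upper_triangular_mats n"
  using assms by (auto simp: upper_triangular_mats_def)

lemma one_upper_triangular_mats: "1\<^sub>m n \<in> upper_triangular_mats n"
  by (rule upper_triangular_matsI) auto

lemma add_upper_triangular_mats: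
  fixes A B :: "'a::monoid_add mat"
  assumes "A \<in> upper_triangular_mats n" "B \<in> upper_triangular_mats n"
  shows "A + B \<in> upper_triangular_mats n"
  using upper_triangular_matsD[OF assms(1)] upper_triangular_matsD[OF assms(2)]
  by (intro upper_triangular_matsI) auto

lemma smult_upper_triangular_mats:
  fixes A :: "'a::mult_zero mat"
  assumes "A \<in> upper_triangular_mats n"
  shows "c \<cdot>\<^sub>m A \<in> upper_triangular_mats n"
  using upper_triangular_matsD[OF assms] by (intro upper_triangular_matsI) auto

lemma mult_upper_triangular_mats:
  fixes A B :: "'a::semiring_0 mat"
  assumes "A \<in> upper_triangular_mats n" "B \<in> upper_triangular_mats n"
  shows "A * B \<in> upper_triangular_mats n"
proof (rule upper_triangular_matsI)
  note A = upper_triangular_matsD[OF assms(1)] and B = upper_triangular_matsD[OF assms(2)]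
  show "A * B \<in> carrier_mat n n" using A(1) B(1) by simp
  fix i j assume ij: "i < n" "j < i"
  have "A $$ (i, k) * B $$ (k, j) = 0" if "k < n" for k
    using A(2)[of i k] B(2)[of k j] ij that by (cases "k < i") auto
  then show "(A * B) $$ (i, j) = 0"
    using A(1) B(1) ij by (simp add: scalar_prod_def)
qed

section \<open>Products of matrix units and the span of the triangular ones\<close>

lemma matrix_unit_upper_triangular_mats:
  "i \<le> j \<Longrightarrow> matrix_unit n i j \<in> upper_triangular_mats n"
  by (rule upper_triangular_matsI) (auto simp: matrix_unit_def)

lemma matrix_unit_mult_index:
  fixes M :: "'a::{comm_ring, comm_monoid_mult} mat"
  assumes "M \<in> carrier_mat n m" "j < n" "k < n" "l < m"
  shows "(matrix_unit n i j * M) $$ (k, l) = (if k = i then M $$ (j, l) else 0)"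
proof -
  have "(matrix_unit n i j * M) $$ (k, l) =
      (\<Sum>s\<in>{0..<n}. matrix_unit n i j $$ (k, s) * M $$ (s, l))"
    using assms by (simp add: matrix_unit_def scalar_prod_def)
  also have "\<dots> = (\<Sum>s\<in>{0..<n}. if s = j then if k = i then M $$ (j, l) else 0 else 0)"
    using assms by (intro sum.cong) (auto simp: matrix_unit_def)
  finally show ?thesis using assms(2) by simp
qed

lemma matrix_unit_mult_matrix_unit:
  assumes "j < n"
  shows "matrix_unit n i j * matrix_unit n k l =
    (if j = k then matrix_unit n i l else 0\<^sub>m n n :: 'a::{comm_ring, comm_monoid_mult} mat)"
proof (rule eq_matI)
  have [simp]: "matrix_unit n p q \<in> carrier_mat n n" for p q
    by (simp add: matrix_unit_def)
  let ?R = "if j = k then matrix_unit n i l else 0\<^sub>m n n :: 'a mat"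
  fix s t assume "s < dim_row ?R" "t < dim_col ?R"
  then have st: "s < n" "t < n" by (auto simp: matrix_unit_def split: if_splits)
  show "(matrix_unit n i j * matrix_unit n k l) $$ (s, t) = ?R $$ (s, t)"
    using st assms
    by (subst matrix_unit_mult_index[where n = n and m = n]) (auto simp: matrix_unit_def)
qed (auto simp: matrix_unit_def)

text \<open>Reduces a linear identity on triangular matrices to the matrix units, by building
  \<open>A\<close> up one entry at a time.\<close>

lemma upper_triangular_mats_span_induct [consumes 1, case_names add smult unit]:
  fixes A :: "'a::{comm_ring, comm_monoid_mult} mat"
  assumes A: "A \<in> upper_triangular_mats n"
    and add: "\<And>A B. A \<in> upper_triangular_mats n \<Longrightarrow> B \<in> upper_triangular_mats n \<Longrightarrow>
      P A \<Longrightarrow> P B \<Longrightarrow> P (A + B)"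
    and smult: "\<And>c A. A \<in> upper_triangular_mats n \<Longrightarrow> P A \<Longrightarrow> P (c \<cdot>\<^sub>m A)"
    and unit: "\<And>i j. i \<le> j \<Longrightarrow> j < n \<Longrightarrow> P (matrix_unit n i j)"
    and "n > 0"
  shows "P A"
proof -
  \<comment> \<open>\<open>?R S\<close> keeps the entries of \<open>A\<close> at the positions in
    \<open>S\<close> and is zero elsewhere; \<open>?I\<close> is the set of positions on or above
    the diagonal, so \<open>?R ?I\<close> is \<open>A\<close>.\<close>
  let ?R = "\<lambda>S. mat n n (\<lambda>p. if p \<in> S then A $$ p else 0)"
  let ?I = "{(i, j). i \<le> j \<and> j < n}"
  note AD = upper_triangular_matsD[OF A]
  have fin: "finite ?I"
    by (rule finite_subset[of _ "{..<n} \<times> {..<n}"]) auto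
  have "P (?R S)" if "finite S" "S \<subseteq> ?I" for S
    using that
  proof (induction S rule: finite_induct)
    case empty
    \<comment> \<open>The zero matrix must come from some matrix unit, and \<open>n > 0\<close>
      supplies e_00.\<close>
    have "?R {} = 0 \<cdot>\<^sub>m matrix_unit n 0 0"
      by (rule eq_matI) (auto simp: matrix_unit_def)
    then show ?case
      using smult[OF matrix_unit_upper_triangular_mats unit] \<open>n > 0\<close> by simp
  next
    case (insert p S)
    obtain i j where p: "p = (i, j)" and ij: "i \<le> j" "j < n" using insert.prems by auto
    have eq: "?R (insert p S) = ?R S + A $$ p \<cdot>\<^sub>m matrix_unit n i j"
      using insert.hyps by (intro eq_matI) (auto simp: matrix_unit_def p)
    have "?R S \<in> upper_triangular_mats n"
      using AD by (intro upper_triangular_matsI) auto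
    then show ?case
      unfolding eq using ij insert
      by (intro add smult unit smult_upper_triangular_mats matrix_unit_upper_triangular_mats) auto
  qed
  from this[OF fin subset_refl] have "P (?R ?I)" .
  moreover have "?R ?I = A"
    using AD by (intro eq_matI) auto
  ultimately show ?thesis by simp
qed

section \<open>Values of \<open>g\<close> and \<open>h\<close> forced by the derivation
  identity\<close>

lemma left_derivation_on_sym:
  assumes "left_derivation_on M g h f"
  shows "left_derivation_on M h g f"
  using assms by (simp add: left_derivation_on_def)

lemma left_derivation_on_idempotent:
  fixes f g h :: "'a::{comm_ring, comm_monoid_mult} mat \<Rightarrow> 'a mat"
  assumes der: "left_derivation_on M g h f"
    and M: "M \<subseteq> carrier_mat n n" "1\<^sub>m n \<in> M"
    and gM: "\<And>A. A \<in> M \<Longrightarrow> g A \<in> M" and hM: "\<And>A. A \<in> M \<Longrightarrow> h A \<in> M"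
    and e: "e \<in> M" "e * e = e"
  shows "g e = e * g (1\<^sub>m n)"
proof -
  let ?G = "g (1\<^sub>m n)" and ?H = "h (1\<^sub>m n)"
  have c [simp]: "e \<in> carrier_mat n n" "g e \<in> carrier_mat n n" "h e \<in> carrier_mat n n"
    "?G \<in> carrier_mat n n" "?H \<in> carrier_mat n n"
    using M gM hM e by auto
  have eX [simp]: "e * X \<in> carrier_mat n n" if "X \<in> carrier_mat n n" for X
    using that by (rule mult_carrier_mat[OF c(1)])
  have ee [simp]: "e * (e * X) = e * X" if "X \<in> carrier_mat n n" for X
    using assoc_mult_mat[of e n n e n X n] e(2) that by simp
  have fe: "f e = e * g e + e * h e"
    using der[unfolded left_derivation_on_def, rule_format, OF e(1) e(1)] e(2) by simp
  \<comment> \<open>The pair (1, e), once in each of the two forms of the identity.\<close>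
  have "f (1\<^sub>m n * e) = 1\<^sub>m n * g e + e * ?H" "f (1\<^sub>m n * e) = 1\<^sub>m n * h e + e * ?G"
    using der[unfolded left_derivation_on_def, rule_format, OF M(2) e(1)] by (blast, argo)
  then have f1: "f e = g e + e * ?H" and f2: "f e = h e + e * ?G"
    by (simp_all add: one_mat_mult[where m = n])
  have "e * f e = f e"
    unfolding fe by (simp add: mult_add_distrib_mat[of e n n _ n])
  then have f3: "f e = e * g e + e * ?H" and f4: "f e = e * h e + e * ?G"
    using arg_cong[OF f1, of "(*) e"] arg_cong[OF f2, of "(*) e"]
    by (simp_all add: mult_add_distrib_mat[of e n n _ n])
  \<comment> \<open>Comparing \<open>fe\<close> with \<open>f4\<close> leaves
    \<open>e * g e = e * ?G\<close>. Then \<open>f1\<close> and \<open>f3\<close> differ only in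
    \<open>g e\<close> against \<open>e * g e\<close>, so cancelling \<open>e * ?H\<close> finishes;
    the sums are reordered to put the common term on the left.\<close>
  have "e * h e + e * g e = e * h e + e * ?G"
    using trans[OF fe[symmetric] f4] comm_add_mat[OF eX[OF c(2)] eX[OF c(3)]] by argo
  then have G: "e * g e = e * ?G"
    by (rule add_mat_left_cancel[where m = n and n = n, rotated 3]) simp_all
  have "e * ?H + g e = g e + e * ?H" by (rule comm_add_mat[where nr = n and nc = n]) simp_all
  also have "\<dots> = e * ?G + e * ?H" using f1 f3 G by argo
  also have "\<dots> = e * ?H + e * ?G" by (rule comm_add_mat[where nr = n and nc = n]) simp_all
  finally show ?thesis by (rule add_mat_left_cancel[where m = n and n = n, rotated 3]) simp_all
qed

text \<open>Both sides are linear in \<open>A\<close>, so matrix units suffice: e_ii is idempotent,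
  and an off-diagonal e_ij is the difference of the idempotents e_ii + e_ij and e_ii.\<close>

lemma left_derivation_on_upper_triangular_mats:
  fixes f g h :: "'a::{comm_ring, comm_monoid_mult} mat \<Rightarrow> 'a mat"
  assumes der: "left_derivation_on (upper_triangular_mats n) g h f"
    and g: "linear_endo_on (upper_triangular_mats n) g"
    and h: "linear_endo_on (upper_triangular_mats n) h"
    and "n > 0" and A: "A \<in> upper_triangular_mats n"
  shows "g A = A * g (1\<^sub>m n)"
proof -
  let ?T = "upper_triangular_mats n :: 'a mat set" and ?e = "\<lambda>i j. matrix_unit n i j :: 'a mat" and ?G = "g (1\<^sub>m n)"
  have G: "?G \<in> carrier_mat n n"
    using g one_upper_triangular_mats[of n]
    by (auto simp: linear_endo_on_def dest: upper_triangular_matsD(1))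
  have gT: "g B \<in> ?T" and hT: "h B \<in> ?T" if "B \<in> ?T" for B
    using g h that by (auto simp: linear_endo_on_def)
  have g_add: "g (B + D) = g B + g D" if "B \<in> ?T" "D \<in> ?T" for B D
    using g that by (auto simp: linear_endo_on_def)
  have g_smult: "g (c \<cdot>\<^sub>m B) = c \<cdot>\<^sub>m g B" if "B \<in> ?T" for B c
    using g that by (auto simp: linear_endo_on_def)
  have sub: "?T \<subseteq> carrier_mat n n" by (auto dest: upper_triangular_matsD(1))
  note idem = left_derivation_on_idempotent[OF der sub one_upper_triangular_mats gT hT]
  note eT = matrix_unit_upper_triangular_mats
  have diag: "g (?e i i) = ?e i i * ?G" if "i < n" for i
    using that by (intro idem) (simp_all add: eT matrix_unit_mult_matrix_unit)
  show ?thesis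
    using A
  proof (induction rule: upper_triangular_mats_span_induct)
    case (add A B)
    then show ?case
      using G by (simp add: g_add upper_triangular_matsD(1) add_mult_distrib_mat[of A n n B ?G n])
  next
    case (smult c A)
    then show ?case
      using G by (simp add: g_smult upper_triangular_matsD(1) mult_smult_assoc_mat[of A n n ?G n])
  next
    case (unit i j)
    show ?case
    proof (cases "i = j")
      case True
      then show ?thesis using diag unit by simp
    next
      case False
      have iiT: "?e i i \<in> ?T" and ijT: "?e i j \<in> ?T"
        using unit by (simp_all add: eT)
      note ii = upper_triangular_matsD(1)[OF iiT] and ij = upper_triangular_matsD(1)[OF ijT]
      \<comment> \<open>Of the four products only e_ii e_ii = e_ii and e_ii e_ij = e_ij survive,
        because i and j differ.\<close>
      have "(?e i i + ?e i j) * (?e i i + ?e i j) =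
          (?e i i * ?e i i + ?e i i * ?e i j) + (?e i j * ?e i i + ?e i j * ?e i j)"
        using ii ij by (simp only: add_mult_distrib_mat[OF ii ij add_carrier_mat[OF ij]]
            mult_add_distrib_mat[OF ii ii ij] mult_add_distrib_mat[OF ij ii ij])
      also have "\<dots> = ?e i i + ?e i j"
        using unit False ii ij by (simp add: matrix_unit_mult_matrix_unit)
      finally have "g (?e i i + ?e i j) = (?e i i + ?e i j) * ?G"
        by (intro idem add_upper_triangular_mats iiT ijT)
      then have "?e i i * ?G + g (?e i j) = ?e i i * ?G + ?e i j * ?G"
        using unit by (simp only: g_add[OF iiT ijT] diag add_mult_distrib_mat[OF ii ij G] le_less_trans)
      then show ?thesis
        by (rule add_mat_left_cancel[OF mult_carrier_mat[OF ii G]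
              upper_triangular_matsD(1)[OF gT[OF ijT]] mult_carrier_mat[OF ij G]])
    qed
  qed (rule \<open>n > 0\<close>)
qed

text \<open>With a = e_00 and b = e_0j one has ab = b but ba = 0. Computing f(b) from the pairs (a,
  b) and (1, b) gives bG + 0 = bG + bH, hence bH = 0. Exchanging \<open>g\<close> and
  \<open>h\<close> gives the same for G.\<close>

lemma left_derivation_on_value_one_rows:
  fixes f g h :: "'a::{comm_ring, comm_monoid_mult} mat \<Rightarrow> 'a mat"
  assumes der: "left_derivation_on (upper_triangular_mats n) g h f"
    and g: "linear_endo_on (upper_triangular_mats n) g"
    and h: "linear_endo_on (upper_triangular_mats n) h"
    and j: "0 < j" "j < n" and l: "l < n"
  shows "h (1\<^sub>m n) $$ (j, l) = 0"
proof -
  let ?T = "upper_triangular_mats n :: 'a mat set" and ?G = "g (1\<^sub>m n)" and ?H = "h (1\<^sub>m n)"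
  let ?a = "matrix_unit n 0 0 :: 'a mat" and ?b = "matrix_unit n 0 j :: 'a mat"
  have GH: "?G \<in> carrier_mat n n" "?H \<in> carrier_mat n n"
    using g h one_upper_triangular_mats[of n]
    by (auto simp: linear_endo_on_def dest: upper_triangular_matsD(1))
  have ab: "?a \<in> ?T" "?b \<in> ?T"
    by (auto intro: matrix_unit_upper_triangular_mats)
  note abc = ab[THEN upper_triangular_matsD(1)]
  have gv: "g A = A * ?G" if "A \<in> ?T" for A
    using left_derivation_on_upper_triangular_mats[OF der g h _ that] j by simp
  have hv: "h A = A * ?H" if "A \<in> ?T" for A
    using left_derivation_on_upper_triangular_mats[OF left_derivation_on_sym[OF der] h g _ that] j
    by simp
  have prod: "?a * ?b = ?b" "?b * ?a = 0\<^sub>m n n"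
    using j by (simp_all add: matrix_unit_mult_matrix_unit)
  have "f (?a * ?b) = ?a * g ?b + ?b * h ?a"
    using der ab by (auto simp: left_derivation_on_def)
  also have "\<dots> = ?b * ?G + 0\<^sub>m n n * ?H"
    unfolding gv[OF ab(2)] hv[OF ab(1)] assoc_mult_mat[OF abc GH(1), symmetric]
      assoc_mult_mat[OF abc(2,1) GH(2), symmetric] prod ..
  finally have 1: "f ?b = ?b * ?G + 0\<^sub>m n n * ?H" by (simp add: prod)
  have "f (1\<^sub>m n * ?b) = 1\<^sub>m n * g ?b + ?b * ?H"
    using der ab one_upper_triangular_mats[of n] unfolding left_derivation_on_def by blast
  then have "f ?b = ?b * ?G + ?b * ?H"
    unfolding gv[OF ab(2)] one_mat_mult[OF abc(2)] one_mat_mult[OF mult_carrier_mat[OF abc(2) GH(1)]] .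
  with 1 have "?b * ?G + ?b * ?H = ?b * ?G + 0\<^sub>m n n * ?H" by argo
  then have "?b * ?H = 0\<^sub>m n n * ?H"
    by (rule add_mat_left_cancel[where m = n and n = n, rotated 3])
      (use abc GH in \<open>simp_all add: mult_carrier_mat[of _ n n _ n]\<close>)
  then have "(?b * ?H) $$ (0, l) = 0"
    using GH l j by (simp add: scalar_prod_def)
  \<comment> \<open>Row 0 of e_0j H is row j of H.\<close>
  then show ?thesis
    using GH j l by (simp add: matrix_unit_mult_index[where m = n])
qed

section \<open>Products with matrices supported on the first row\<close>

lemma mult_mat_index_first:
  fixes A B :: "'a::semiring_0 mat"
  assumes "A \<in> carrier_mat m n" "B \<in> carrier_mat n p" "0 < n" "k < m" "l < p"
    and "\<And>j. 0 < j \<Longrightarrow> j < n \<Longrightarrow> B $$ (j, l) = 0"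
  shows "(A * B) $$ (k, l) = A $$ (k, 0) * B $$ (0, l)"
proof -
  have "(A * B) $$ (k, l) = (\<Sum>j\<in>{0..<n}. A $$ (k, j) * B $$ (j, l))"
    using assms by (simp add: scalar_prod_def)
  also have "\<dots> = (\<Sum>j\<in>{0..<n}. if j = 0 then A $$ (k, 0) * B $$ (0, l) else 0)"
    using assms by (intro sum.cong) auto
  finally show ?thesis using assms(3) by simp
qed

text \<open>Only column 0 of \<open>A\<close> meets the nonzero row of \<open>U\<close>, and
  triangularity leaves \<open>A $$ (0, 0)\<close> as the only possibly nonzero entry of that
  column.\<close>

lemma upper_triangular_mats_mult_first_row:
  fixes A U :: "'a::semiring_0 mat"
  assumes A: "A \<in> upper_triangular_mats n" and U: "U \<in> carrier_mat n n"
    and "\<And>j l. 0 < j \<Longrightarrow> j < n \<Longrightarrow> l < n \<Longrightarrow> U $$ (j, l) = 0"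
  shows "A * U = A $$ (0, 0) \<cdot>\<^sub>m U"
proof (rule eq_matI)
  note AD = upper_triangular_matsD[OF A]
  fix k l assume "k < dim_row (A $$ (0, 0) \<cdot>\<^sub>m U)" "l < dim_col (A $$ (0, 0) \<cdot>\<^sub>m U)"
  then have kl: "k < n" "l < n" using U by auto
  then show "(A * U) $$ (k, l) = (A $$ (0, 0) \<cdot>\<^sub>m U) $$ (k, l)"
    using AD U assms(3)
    by (subst mult_mat_index_first[where n = n and m = n and p = n]) (cases "k = 0"; auto)+
qed (use upper_triangular_matsD(1)[OF A] U in auto)

text \<open>Brings the sums of the characterization into the form of a scalar times a fixed matrix
  supported on the first row.\<close>

lemma mats_sum_first_row:
  fixes u :: "nat \<Rightarrow> 'a::{comm_ring, comm_monoid_mult}"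
  shows "mats_sum n (\<lambda>i. (a * u i) \<cdot>\<^sub>m matrix_unit n 0 i) {0..<n} =
    a \<cdot>\<^sub>m mat n n (\<lambda>(k, l). if k = 0 then u l else 0)"
proof (rule eq_matI)
  let ?U = "mat n n (\<lambda>(k, l). if k = 0 then u l else 0)"
  fix k l assume "k < dim_row (a \<cdot>\<^sub>m ?U)" "l < dim_col (a \<cdot>\<^sub>m ?U)"
  then have kl: "k < n" "l < n" by auto
  have "(\<Sum>i\<in>{0..<n}. ((a * u i) \<cdot>\<^sub>m matrix_unit n 0 i) $$ (k, l)) =
      (\<Sum>i\<in>{0..<n}. if i = l then if k = 0 then a * u l else 0 else 0)"
    using kl by (intro sum.cong) (auto simp: matrix_unit_def)
  then show "mats_sum n (\<lambda>i. (a * u i) \<cdot>\<^sub>m matrix_unit n 0 i) {0..<n} $$ (k, l) = (a \<cdot>\<^sub>m ?U) $$ (k, l)"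
    using kl by (simp add: mats_sum_def)
qed (auto simp: mats_sum_def)

section \<open>The two implications of the characterization\<close>

theorem theorem2p6:
  fixes f g h :: "'a::{comm_ring, comm_monoid_mult} mat \<Rightarrow> 'a mat" and n :: nat
  assumes "two_torsion_free TYPE('a)"
    and "n \<ge> 2"
    and "linear_endo_on (upper_triangular_mats n) f"
    and "linear_endo_on (upper_triangular_mats n) g"
    and "linear_endo_on (upper_triangular_mats n) h"
  shows "left_derivation_on (upper_triangular_mats n) g h f \<longleftrightarrow>
    (\<exists>g11 h11 :: nat \<Rightarrow> 'a. \<forall>A \<in> upper_triangular_mats n.
       g A = mats_sum n (\<lambda>i. (A $$ (0, 0) * g11 i) \<cdot>\<^sub>m matrix_unit n 0 i) {0..<n} \<and>
       h A = mats_sum n (\<lambda>i. (A $$ (0, 0) * h11 i) \<cdot>\<^sub>m matrix_unit n 0 i) {0..<n} \<and>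
       f A = g A + h A)"
    (is "?L \<longleftrightarrow> ?R")
proof
  let ?T = "upper_triangular_mats n :: 'a mat set"
  let ?row = "\<lambda>u. mat n n (\<lambda>(k, l). if k = 0 then u l else 0) :: 'a mat"
  have n: "0 < n" using assms(2) by simp
  {
    assume der: ?L
    note der' = left_derivation_on_sym[OF der]
    let ?G = "g (1\<^sub>m n)" and ?H = "h (1\<^sub>m n)"
    have GH: "?G \<in> carrier_mat n n" "?H \<in> carrier_mat n n"
      using assms(4,5) one_upper_triangular_mats[of n]
      by (auto simp: linear_endo_on_def dest: upper_triangular_matsD(1))
    note H0 = left_derivation_on_value_one_rows[OF der assms(4,5)]
    note G0 = left_derivation_on_value_one_rows[OF der' assms(5,4)]
    \<comment> \<open>The witnesses are the first rows of g(1) and h(1); all other rows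
      vanish.\<close>
    have G: "?G = ?row (\<lambda>l. ?G $$ (0, l))" and H: "?H = ?row (\<lambda>l. ?H $$ (0, l))"
      using GH G0 H0 by (auto intro!: eq_matI)
    {
      fix A :: "'a mat" assume A: "A \<in> ?T"
      have gA: "g A = A * ?G"
        using left_derivation_on_upper_triangular_mats[OF der assms(4,5) n A] .
      have hA: "h A = A * ?H"
        using left_derivation_on_upper_triangular_mats[OF der' assms(5,4) n A] .
      have "g A = A $$ (0, 0) \<cdot>\<^sub>m ?row (\<lambda>l. ?G $$ (0, l))"
        using upper_triangular_mats_mult_first_row[OF A GH(1) G0] gA by (simp flip: G)
      moreover have "h A = A $$ (0, 0) \<cdot>\<^sub>m ?row (\<lambda>l. ?H $$ (0, l))"
        using upper_triangular_mats_mult_first_row[OF A GH(2) H0] hA by (simp flip: H)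
      moreover have "f A = g A + h A"
      proof -
        \<comment> \<open>The pair (1, A) gives f(A) = g(A) + AH, and AH is h(A).\<close>
        have "f (1\<^sub>m n * A) = 1\<^sub>m n * g A + A * ?H"
          using der A one_upper_triangular_mats[of n] unfolding left_derivation_on_def by blast
        then show ?thesis
          using upper_triangular_matsD(1)[OF A] GH hA gA by (simp add: one_mat_mult[where m = n])
      qed
      ultimately have "g A = A $$ (0, 0) \<cdot>\<^sub>m ?row (\<lambda>l. ?G $$ (0, l)) \<and>
          h A = A $$ (0, 0) \<cdot>\<^sub>m ?row (\<lambda>l. ?H $$ (0, l)) \<and> f A = g A + h A"
        by (intro conjI)
    }
    then show ?R unfolding mats_sum_first_row by (intro exI ballI)
  next
    assume ?R
    then obtain u v where uv: "\<forall>A \<in> ?T.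
        g A = A $$ (0, 0) \<cdot>\<^sub>m ?row u \<and> h A = A $$ (0, 0) \<cdot>\<^sub>m ?row v \<and> f A = g A + h A"
      unfolding mats_sum_first_row by (elim exE)
    \<comment> \<open>For the converse, left multiplication by \<open>A\<close> scales such a row
      matrix by \<open>A $$ (0, 0)\<close>, and by \<open>idx\<close> this entry is multiplicative.
      All terms of the identity thus become multiples of \<open>?row u\<close> or
      \<open>?row v\<close> by the product of the (0, 0) entries of \<open>A\<close> and
      \<open>B\<close>, which is symmetric in \<open>A\<close> and \<open>B\<close>.\<close>
    have mult: "A * (c \<cdot>\<^sub>m ?row w) = (A $$ (0, 0) * c) \<cdot>\<^sub>m ?row w" if "A \<in> ?T" for A c w
      using that
      by (subst upper_triangular_mats_mult_first_row)
        (auto intro!: eq_matI simp: mult.assoc)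
    have idx: "(A * B) $$ (0, 0) = A $$ (0, 0) * B $$ (0, 0)" if "A \<in> ?T" "B \<in> ?T" for A B
      using that n upper_triangular_matsD[of A n] upper_triangular_matsD[of B n]
      by (intro mult_mat_index_first[where n = n and m = n and p = n]) auto
    show ?L
      unfolding left_derivation_on_def
    proof (intro ballI conjI)
      fix A B assume AB: "A \<in> ?T" "B \<in> ?T"
      note v = bspec[OF uv AB(1)] bspec[OF uv AB(2)] bspec[OF uv mult_upper_triangular_mats[OF AB]]
      show "f (A * B) = A * g B + B * h A"
        using v AB by (simp add: mult idx mult.commute)
      show "A * g B + B * h A = A * h B + B * g A"
        using v AB by (simp add: mult mult.commute comm_add_mat[where nr = n and nc = n])
    qed
  }
qed

end
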